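(* Let $0<\alpha<1$ and $k(0)\in(0,1)$, let $f(k)=k^\alpha$, and let $k^\circ(t)=\lim_{T\to\infty}k_T(t)$, where $k_T$ is the optimal capital path of the undiscounted $T$-horizon problem of the context. Then the optimal saving ratio is constant over time: for all integers $t\ge 0$, $$\frac{k^\circ(t+1)}{f(k^\circ(t))}=\alpha .$$
   Context: For an integer $T\ge 0$, the $T$-horizon problem is: maximize $\sum_{t=0}^{T}\ln c(t)$ subject to $c(t)+k(t+1)=f(k(t))=k(t)^\alpha$ for $0\le t\le T$, $k(0)$ given, $0<k(t)<1$ for $0\le t\le T$, and $k(T+1)=0$. It has a unique optimal solution $(k_T(t),c_T(t))$, and for each fixed $t$ the limit of $k_T(t)$ as $T\to\infty$ exists. *)

theory Defs
  imports Complex_Main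
begin

definition production :: "real \<Rightarrow> real \<Rightarrow> real" where
  "production \<alpha> k = k powr \<alpha>"

text \<open>
  Consumption is required to be positive: this is the domain condition of the
  objective, which has to be explicit because \<^const>\<open>ln\<close> is total in HOL.
\<close>
definition feasible :: "real \<Rightarrow> real \<Rightarrow> nat \<Rightarrow> (nat \<Rightarrow> real) \<Rightarrow> (nat \<Rightarrow> real) \<Rightarrow> bool" where
  "feasible \<alpha> k0 T k c \<longleftrightarrow>
     k 0 = k0 \<and>
     (\<forall>t\<le>T. c t + k (t + 1) = production \<alpha> (k t)) \<and>
     (\<forall>t\<le>T. 0 < k t \<and> k t < 1) \<and>
     (\<forall>t\<le>T. 0 < c t) \<and>
     k (T + 1) = 0"

definition utility :: "nat \<Rightarrow> (nat \<Rightarrow> real) \<Rightarrow> real" where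
  "utility T c = (\<Sum>t=0..T. ln (c t))"

definition optimal :: "real \<Rightarrow> real \<Rightarrow> nat \<Rightarrow> (nat \<Rightarrow> real) \<Rightarrow> (nat \<Rightarrow> real) \<Rightarrow> bool" where
  "optimal \<alpha> k0 T k c \<longleftrightarrow>
     feasible \<alpha> k0 T k c \<and>
     (\<forall>k' c'. feasible \<alpha> k0 T k' c' \<longrightarrow> utility T c' \<le> utility T c)"

text \<open>
  The problem constrains \<open>k\<close> only at times up to \<open>T + 1\<close>, so an optimal
  \<open>k :: nat \<Rightarrow> real\<close> is not unique as a function; its value at each time
  \<open>t \<le> T + 1\<close> is.  The description is therefore applied to the value.
\<close>
definition opt_capital :: "real \<Rightarrow> real \<Rightarrow> nat \<Rightarrow> nat \<Rightarrow> real" where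
  "opt_capital \<alpha> k0 T t = (THE x. \<exists>k c. optimal \<alpha> k0 T k c \<and> x = k t)"

definition limit_capital :: "real \<Rightarrow> real \<Rightarrow> nat \<Rightarrow> real" where
  "limit_capital \<alpha> k0 t = lim (\<lambda>T. opt_capital \<alpha> k0 T t)"

end

(* The value function with n + 1 consumption dates left is a * ln k + const with
   a = \<alpha> (1 + \<alpha> + ... + \<alpha>^n).  Measuring a feasible path against it, each period loses
   a nonnegative amount (by ln x <= x - 1), which vanishes exactly when the fraction
   1 / (1 + \<alpha> + ... + \<alpha>^n) of output is consumed.  These losses telescope to the gap between the
   utility of the path and a constant, so the optimal path saves at the rate
   \<alpha> (1 + ... + \<alpha>^(n-1)) / (1 + ... + \<alpha>^n), which tends to \<alpha> as the horizon grows. *)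
theory Submission
  imports Defs
begin

section \<open>Dividing one period's output between consumption and capital\<close>

text \<open>Tangent bounds for the logarithm at the best split cancel because of the budget.
  Positivity of \<open>k\<close> is tied to \<open>0 < a\<close> so that the last date, with
  \<open>a = 0\<close> and \<open>k = 0\<close>, is covered.\<close>

lemma log_split_le:
  fixes a c k y :: real
  assumes a: "0 \<le> a" and c: "0 < c" and k: "0 < a \<Longrightarrow> 0 < k" "0 \<le> k" and y: "c + k = y"
  shows "ln c + a * ln k \<le> (1 + a) * ln y + a * ln a - (1 + a) * ln (1 + a)"
    and "ln c + a * ln k = (1 + a) * ln y + a * ln a - (1 + a) * ln (1 + a) \<Longrightarrow> c = y / (1 + a)"
    and "c = y / (1 + a) \<Longrightarrow> ln c + a * ln k = (1 + a) * ln y + a * ln a - (1 + a) * ln (1 + a)"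
proof -
  \<comment> \<open>The best split is \<open>p\<close> for consumption and \<open>a * p\<close> for
    capital; \<open>u\<close> and \<open>w\<close> are the ratios to it. For \<open>a = 0\<close>
    the default \<open>w = 0\<close> is harmless, since \<open>w\<close> enters the bound only as
    \<open>a * ln w\<close>.\<close>
  define p where "p = y / (1 + a)"
  define u where "u = c / p"
  define w where "w = k / (a * p)"
  have ypos: "0 < y" using c k(2) y by linarith
  have ppos: "0 < p" using ypos a by (simp add: p_def)
  have upos: "0 < u" using c ppos by (simp add: u_def)
  have ln_c: "ln c = ln p + ln u" using c ppos by (simp add: u_def ln_div)
  have ln_y: "ln y = ln p + ln (1 + a)" using ypos a by (simp add: p_def ln_div)
  have u_le: "ln u \<le> u - 1" using upos by (rule ln_le_minus_one)
  have gap: "ln c + a * ln k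
      = (1 + a) * ln y + a * ln a - (1 + a) * ln (1 + a) + (ln u + a * ln w)"
  proof (cases "a = 0")
    case True
    then show ?thesis using ln_c ln_y by simp
  next
    case False
    then have "0 < a" "0 < k" using a k by auto
    then have ln_k: "ln k = ln w + (ln a + ln p)"
      using ppos by (simp add: w_def ln_div ln_mult)
    show ?thesis unfolding ln_c ln_y ln_k by (simp add: algebra_simps)
  qed
  have tangent: "a * ln w \<le> 1 - u"
  proof (cases "a = 0")
    case True
    then have "p = y" by (simp add: p_def)
    then have "u \<le> 1" using ypos y k(2) by (simp add: u_def)
    then show ?thesis using True by simp
  next
    case False
    then have "0 < a" "0 < k" using a k by auto
    then have "0 < w" using ppos by (simp add: w_def)
    then have "a * ln w \<le> a * (w - 1)"
      using a by (intro mult_left_mono ln_le_minus_one) auto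
    moreover have "u + a * w = 1 + a"
    proof -
      have "u + a * w = (c + k) / p"
        using False by (simp add: u_def w_def add_divide_distrib)
      also have "\<dots> = 1 + a"
        using ypos a y by (simp add: p_def)
      finally show ?thesis .
    qed
    ultimately show ?thesis by (simp add: algebra_simps)
  qed
  show "ln c + a * ln k \<le> (1 + a) * ln y + a * ln a - (1 + a) * ln (1 + a)"
    using gap tangent u_le by linarith
  show "c = y / (1 + a)"
    if "ln c + a * ln k = (1 + a) * ln y + a * ln a - (1 + a) * ln (1 + a)"
  proof -
    \<comment> \<open>The upper bounds \<open>u - 1\<close> and \<open>1 - u\<close> add up to zero,
      so a zero gap makes both tight.\<close>
    have "ln u = u - 1" using that gap tangent u_le by linarith
    then have "u = 1" using upos by (simp add: ln_eq_minus_one)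
    then have "c = p" using ppos by (simp add: u_def)
    then show ?thesis by (simp add: p_def)
  qed
  show "ln c + a * ln k = (1 + a) * ln y + a * ln a - (1 + a) * ln (1 + a)"
    if "c = y / (1 + a)"
  proof -
    have u1: "u = 1" using that[folded p_def] ppos by (simp add: u_def)
    have "a * ln w = 0"
    proof (cases "a = 0")
      case False
      have "c = p" "y = (1 + a) * p" using that a by (simp_all add: p_def)
      then have "k = a * p" using y by (simp add: algebra_simps)
      then show ?thesis using False ppos by (simp add: w_def)
    qed simp
    then show ?thesis using gap u1 by simp
  qed
qed

section \<open>Geometric sums and saving rates\<close>

definition geom_sum :: "real \<Rightarrow> nat \<Rightarrow> real" where
  "geom_sum \<alpha> n = (\<Sum>i<n. \<alpha> ^ i)"

lemma geom_sum_0 [simp]: "geom_sum \<alpha> 0 = 0"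
  by (simp add: geom_sum_def)

text \<open>Splitting off the first term matches backward induction: if next capital has weight
  \<open>a = \<alpha> * geom_sum \<alpha> n\<close>, current output has weight
  \<open>1 + a\<close>.\<close>

lemma geom_sum_Suc: "geom_sum \<alpha> (Suc n) = 1 + \<alpha> * geom_sum \<alpha> n"
  unfolding geom_sum_def by (subst sum.lessThan_Suc_shift) (simp add: sum_distrib_left)

lemma geom_sum_nonneg: "0 \<le> \<alpha> \<Longrightarrow> 0 \<le> geom_sum \<alpha> n"
  by (simp add: geom_sum_def sum_nonneg)

lemma geom_sum_Suc_pos: "0 \<le> \<alpha> \<Longrightarrow> 0 < geom_sum \<alpha> (Suc n)"
  using geom_sum_nonneg[of \<alpha> n] by (simp add: geom_sum_Suc add_pos_nonneg)

text \<open>The rate when \<open>n\<close> further consumption dates follow the current one.\<close>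
definition saving_rate :: "real \<Rightarrow> nat \<Rightarrow> real" where
  "saving_rate \<alpha> n = \<alpha> * geom_sum \<alpha> n / geom_sum \<alpha> (Suc n)"

lemma saving_rate_0 [simp]: "saving_rate \<alpha> 0 = 0"
  by (simp add: saving_rate_def)

lemma saving_rate_pos: "0 < \<alpha> \<Longrightarrow> 0 < saving_rate \<alpha> (Suc n)"
  by (simp add: saving_rate_def geom_sum_Suc_pos)

lemma one_minus_saving_rate:
  assumes "0 \<le> \<alpha>" shows "1 - saving_rate \<alpha> n = 1 / (1 + \<alpha> * geom_sum \<alpha> n)"
  using geom_sum_Suc_pos[OF assms, of n]
  by (simp add: saving_rate_def geom_sum_Suc field_simps)

lemma saving_rate_less_1:
  assumes "0 \<le> \<alpha>" shows "saving_rate \<alpha> n < 1"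
  using geom_sum_Suc_pos[OF assms, of n]
  by (simp add: saving_rate_def geom_sum_Suc)

text \<open>Both geometric sums in the quotient have the same nonzero limit, so only the factor
  \<alpha> survives.\<close>

lemma saving_rate_tendsto:
  assumes "0 < \<alpha>" "\<alpha> < 1" shows "saving_rate \<alpha> \<longlonglongrightarrow> \<alpha>"
proof -
  have *: "geom_sum \<alpha> \<longlonglongrightarrow> 1 / (1 - \<alpha>)"
    using geometric_sums[of \<alpha>] assms by (simp add: sums_def geom_sum_def[abs_def])
  have "(\<lambda>n. \<alpha> * geom_sum \<alpha> n / geom_sum \<alpha> (Suc n)) \<longlonglongrightarrow> \<alpha> * (1 / (1 - \<alpha>)) / (1 / (1 - \<alpha>))"
    using assms by (intro tendsto_intros * LIMSEQ_Suc[OF *]) auto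
  then show ?thesis using assms by (simp add: saving_rate_def[abs_def])
qed

section \<open>Candidate path and losses against the value function\<close>

primrec saving_path :: "real \<Rightarrow> real \<Rightarrow> nat \<Rightarrow> nat \<Rightarrow> real" where
  "saving_path \<alpha> k0 T 0 = k0"
| "saving_path \<alpha> k0 T (Suc t) = saving_rate \<alpha> (T - t) * production \<alpha> (saving_path \<alpha> k0 T t)"

definition consumption_path :: "real \<Rightarrow> real \<Rightarrow> nat \<Rightarrow> nat \<Rightarrow> real" where
  "consumption_path \<alpha> k0 T t
     = production \<alpha> (saving_path \<alpha> k0 T t) / (1 + \<alpha> * geom_sum \<alpha> (T - t))"

text \<open>The slack in the Bellman inequality at date \<open>t\<close>. Only this date's constant
  appears, as the later ones cancel between the two sides.\<close>

definition period_loss :: "real \<Rightarrow> nat \<Rightarrow> (nat \<Rightarrow> real) \<Rightarrow> (nat \<Rightarrow> real) \<Rightarrow> nat \<Rightarrow> real" where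
  "period_loss \<alpha> T k c t =
     (let a = \<alpha> * geom_sum \<alpha> (T - t) in
        \<alpha> * geom_sum \<alpha> (Suc T - t) * ln (k t) + (a * ln a - (1 + a) * ln (1 + a))
          - (ln (c t) + a * ln (k (t + 1))))"

text \<open>The value function at \<open>k0\<close>, with its additive constant collected date by
  date.\<close>

definition utility_bound :: "real \<Rightarrow> real \<Rightarrow> nat \<Rightarrow> real" where
  "utility_bound \<alpha> k0 T = \<alpha> * geom_sum \<alpha> (Suc T) * ln k0 +
     (\<Sum>t=0..T. let a = \<alpha> * geom_sum \<alpha> (T - t) in a * ln a - (1 + a) * ln (1 + a))"

lemma period_loss_nonneg_eq_0_iff:
  assumes \<alpha>: "0 < \<alpha>" and f: "feasible \<alpha> k0 T k c" and t: "t \<le> T"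
  shows "0 \<le> period_loss \<alpha> T k c t"
    and "period_loss \<alpha> T k c t = 0 \<longleftrightarrow>
           c t = production \<alpha> (k t) / (1 + \<alpha> * geom_sum \<alpha> (T - t))"
proof -
  define a where "a = \<alpha> * geom_sum \<alpha> (T - t)"
  have a: "0 \<le> a" using \<alpha> geom_sum_nonneg[of \<alpha>] by (simp add: a_def)
  have kt: "0 < k t" and ct: "0 < c t" and bal: "c t + k (t + 1) = production \<alpha> (k t)"
    using f t unfolding feasible_def by auto
  have next_nonneg: "0 \<le> k (t + 1)" and next_pos: "0 < a \<Longrightarrow> 0 < k (t + 1)"
  proof -
    show "0 < k (t + 1)" if "0 < a"
    proof -
      \<comment> \<open>At \<open>t = T\<close> the geometric sum is empty, which gives
        \<open>a = 0\<close>.\<close>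
      have "t \<noteq> T" using that by (auto simp: a_def)
      then show ?thesis using f t unfolding feasible_def by auto
    qed
    show "0 \<le> k (t + 1)"
    proof (cases "t = T")
      case True
      then show ?thesis using f unfolding feasible_def by simp
    next
      case False
      then have "t + 1 \<le> T" using t by simp
      then show ?thesis using f unfolding feasible_def by (meson less_imp_le)
    qed
  qed
  have "Suc T - t = Suc (T - t)" using t by simp
  then have "\<alpha> * geom_sum \<alpha> (Suc T - t) * ln (k t) = (1 + a) * ln (production \<alpha> (k t))"
    using kt by (simp add: geom_sum_Suc a_def production_def ln_powr)
  then have loss: "period_loss \<alpha> T k c t =
      (1 + a) * ln (production \<alpha> (k t)) + a * ln a - (1 + a) * ln (1 + a)
        - (ln (c t) + a * ln (k (t + 1)))"
    by (simp add: period_loss_def Let_def a_def)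
  note split = log_split_le[OF a ct next_pos next_nonneg bal]
  show "0 \<le> period_loss \<alpha> T k c t" using split(1) loss by simp
  show "period_loss \<alpha> T k c t = 0 \<longleftrightarrow>
          c t = production \<alpha> (k t) / (1 + \<alpha> * geom_sum \<alpha> (T - t))"
    using split(2,3) loss unfolding a_def[symmetric] by force
qed

text \<open>Each loss contains the difference of the log-capital terms at consecutive dates, so the
  sum keeps only the two ends.\<close>

lemma utility_eq_bound_minus_loss:
  assumes "feasible \<alpha> k0 T k c"
  shows "utility T c = utility_bound \<alpha> k0 T - (\<Sum>t=0..T. period_loss \<alpha> T k c t)"
proof -
  define v where "v t = \<alpha> * geom_sum \<alpha> (Suc T - t) * ln (k t)" for t
  have "(\<Sum>t=0..T. v (Suc t) - v t) = v (Suc T) - v 0"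
    by (rule sum_Suc_diff) simp
  \<comment> \<open>At \<open>Suc T\<close> the coefficient is an empty sum, so the term vanishes
    whatever value \<open>ln 0\<close> has.\<close>
  moreover have "v (Suc T) = 0" "v 0 = \<alpha> * geom_sum \<alpha> (Suc T) * ln k0"
    using assms by (simp_all add: v_def feasible_def)
  ultimately have tele: "(\<Sum>t=0..T. v (Suc t) - v t) = - (\<alpha> * geom_sum \<alpha> (Suc T) * ln k0)"
    by simp
  have "(\<Sum>t=0..T. period_loss \<alpha> T k c t) =
      (\<Sum>t=0..T. (let a = \<alpha> * geom_sum \<alpha> (T - t) in a * ln a - (1 + a) * ln (1 + a))
         - ln (c t) - (v (Suc t) - v t))"
    by (rule sum.cong) (simp_all add: period_loss_def v_def Let_def)
  then show ?thesis
    using tele by (simp add: utility_def utility_bound_def sum_subtractf)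
qed

section \<open>Feasibility, optimality and uniqueness\<close>

lemma saving_path_in_unit_interval:
  assumes "0 < \<alpha>" "0 < k0" "k0 < 1" "t \<le> T"
  shows "0 < saving_path \<alpha> k0 T t \<and> saving_path \<alpha> k0 T t < 1"
  using assms(4)
proof (induction t)
  case 0
  then show ?case using assms by simp
next
  case (Suc t)
  \<comment> \<open>At least one date must remain after \<open>t\<close>, since the rate with none
    remaining is zero.\<close>
  obtain n where n: "T - t = Suc n" using Suc.prems by (cases "T - t") auto
  have f: "0 < production \<alpha> (saving_path \<alpha> k0 T t)" "production \<alpha> (saving_path \<alpha> k0 T t) < 1"
    using Suc assms(1) powr_less_mono2[of \<alpha> "saving_path \<alpha> k0 T t" 1]
    by (auto simp: production_def)
  have s: "0 < saving_rate \<alpha> (T - t)" "saving_rate \<alpha> (T - t) < 1"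
    using assms(1) by (simp_all add: n saving_rate_pos saving_rate_less_1)
  have "saving_rate \<alpha> (T - t) * production \<alpha> (saving_path \<alpha> k0 T t) < 1 * 1"
    by (rule mult_strict_mono) (use f s in auto)
  then show ?case using f s by simp
qed

lemma feasible_saving_path:
  assumes "0 < \<alpha>" "0 < k0" "k0 < 1"
  shows "feasible \<alpha> k0 T (saving_path \<alpha> k0 T) (consumption_path \<alpha> k0 T)"
  unfolding feasible_def
proof (intro conjI allI impI)
  fix t assume t: "t \<le> T"
  note unit = saving_path_in_unit_interval[OF assms t]
  show "0 < saving_path \<alpha> k0 T t" "saving_path \<alpha> k0 T t < 1"
    using unit by auto
  have "consumption_path \<alpha> k0 T t
      = (1 - saving_rate \<alpha> (T - t)) * production \<alpha> (saving_path \<alpha> k0 T t)"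
    using assms(1) by (simp add: consumption_path_def one_minus_saving_rate)
  then show "consumption_path \<alpha> k0 T t + saving_path \<alpha> k0 T (t + 1)
      = production \<alpha> (saving_path \<alpha> k0 T t)"
    by (simp add: algebra_simps)
  show "0 < consumption_path \<alpha> k0 T t"
    using unit geom_sum_Suc_pos[of \<alpha> "T - t"] assms(1)
    by (simp add: consumption_path_def production_def geom_sum_Suc)
\<comment> \<open>Terminal capital is zero because \<open>saving_rate \<alpha> 0\<close> is.\<close>
qed simp_all

lemma utility_le_bound:
  assumes "0 < \<alpha>" "feasible \<alpha> k0 T k c"
  shows "utility T c \<le> utility_bound \<alpha> k0 T"
proof -
  have "0 \<le> (\<Sum>t=0..T. period_loss \<alpha> T k c t)"
    by (rule sum_nonneg) (simp add: period_loss_nonneg_eq_0_iff(1)[OF assms])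
  then show ?thesis using utility_eq_bound_minus_loss[OF assms(2)] by simp
qed

lemma utility_consumption_path:
  assumes "0 < \<alpha>" "0 < k0" "k0 < 1"
  shows "utility T (consumption_path \<alpha> k0 T) = utility_bound \<alpha> k0 T"
proof -
  note f = feasible_saving_path[OF assms, of T]
  have "period_loss \<alpha> T (saving_path \<alpha> k0 T) (consumption_path \<alpha> k0 T) t = 0" if "t \<le> T" for t
    using period_loss_nonneg_eq_0_iff(2)[OF assms(1) f that] by (simp add: consumption_path_def)
  then show ?thesis using utility_eq_bound_minus_loss[OF f] by simp
qed

lemma optimal_saving_path:
  assumes "0 < \<alpha>" "0 < k0" "k0 < 1"
  shows "optimal \<alpha> k0 T (saving_path \<alpha> k0 T) (consumption_path \<alpha> k0 T)"
  using feasible_saving_path[OF assms] utility_consumption_path[OF assms]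
    utility_le_bound[OF assms(1)]
  by (simp add: optimal_def)

text \<open>An optimal path attains \<open>utility_bound\<close>, so its nonnegative losses all
  vanish. This fixes the consumed fraction at each date, and the budget then determines capital
  forward from \<open>k0\<close>.\<close>

lemma optimal_unique:
  assumes "0 < \<alpha>" "0 < k0" "k0 < 1" and opt: "optimal \<alpha> k0 T k c" and "t \<le> T + 1"
  shows "k t = saving_path \<alpha> k0 T t"
proof -
  have f: "feasible \<alpha> k0 T k c" using opt by (simp add: optimal_def)
  have "utility_bound \<alpha> k0 T \<le> utility T c"
    using opt feasible_saving_path[OF assms(1-3)] utility_consumption_path[OF assms(1-3), of T]
    unfolding optimal_def by metis
  then have "(\<Sum>t=0..T. period_loss \<alpha> T k c t) \<le> 0"
    using utility_eq_bound_minus_loss[OF f] by simp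
  moreover have "0 \<le> (\<Sum>t=0..T. period_loss \<alpha> T k c t)"
    by (rule sum_nonneg) (simp add: period_loss_nonneg_eq_0_iff(1)[OF assms(1) f])
  ultimately have "(\<Sum>t=0..T. period_loss \<alpha> T k c t) = 0" by simp
  then have "\<forall>t\<in>{0..T}. period_loss \<alpha> T k c t = 0"
    by (subst (asm) sum_nonneg_eq_0_iff) (simp_all add: period_loss_nonneg_eq_0_iff(1)[OF assms(1) f])
  then have c: "c t = production \<alpha> (k t) / (1 + \<alpha> * geom_sum \<alpha> (T - t))" if "t \<le> T" for t
    using period_loss_nonneg_eq_0_iff(2)[OF assms(1) f that] that by simp
  show ?thesis
    using \<open>t \<le> T + 1\<close>
  proof (induction t)
    case 0
    then show ?case using f by (simp add: feasible_def)
  next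
    case (Suc t)
    then have t: "t \<le> T" and IH: "k t = saving_path \<alpha> k0 T t" by simp_all
    have "c t = (1 - saving_rate \<alpha> (T - t)) * production \<alpha> (k t)"
      using c[OF t] assms(1) by (simp add: one_minus_saving_rate)
    moreover have "c t + k (Suc t) = production \<alpha> (k t)"
      using f t by (simp add: feasible_def)
    ultimately show ?case using IH by (simp add: algebra_simps)
  qed
qed

lemma opt_capital_eq_saving_path:
  assumes "0 < \<alpha>" "0 < k0" "k0 < 1" "t \<le> T + 1"
  shows "opt_capital \<alpha> k0 T t = saving_path \<alpha> k0 T t"
  unfolding opt_capital_def
  using optimal_saving_path[OF assms(1-3)] optimal_unique[OF assms(1-3) _ assms(4)]
  by (intro the_equality) blast+

section \<open>Passage to the infinite horizon\<close>

text \<open>Stationary refers to the constant saving rate; capital itself generally varies.\<close>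

primrec stationary_path :: "real \<Rightarrow> real \<Rightarrow> nat \<Rightarrow> real" where
  "stationary_path \<alpha> k0 0 = k0"
| "stationary_path \<alpha> k0 (Suc t) = \<alpha> * production \<alpha> (stationary_path \<alpha> k0 t)"

lemma stationary_path_pos:
  assumes "0 < \<alpha>" "0 < k0" shows "0 < stationary_path \<alpha> k0 t"
  by (induction t) (use assms in \<open>simp_all add: production_def\<close>)

text \<open>For a fixed date the number of remaining dates grows with \<open>T\<close>, so the
  finitely many rates used up to it all tend to \<alpha>.\<close>

lemma saving_path_tendsto:
  assumes "0 < \<alpha>" "\<alpha> < 1" "0 < k0"
  shows "(\<lambda>T. saving_path \<alpha> k0 T t) \<longlonglongrightarrow> stationary_path \<alpha> k0 t"
proof (induction t)
  case 0
  then show ?case by simp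
next
  case (Suc t)
  have "filterlim (\<lambda>T. T - t) sequentially sequentially"
    by (rule filterlim_minus_const_nat_at_top)
  then have "(\<lambda>T. saving_rate \<alpha> (T - t)) \<longlonglongrightarrow> \<alpha>"
    by (rule filterlim_compose[OF saving_rate_tendsto[OF assms(1,2)]])
  moreover have "(\<lambda>T. saving_path \<alpha> k0 T t powr \<alpha>) \<longlonglongrightarrow> stationary_path \<alpha> k0 t powr \<alpha>"
    \<comment> \<open>Continuity of \<open>powr\<close> is applied at a nonzero base.\<close>
    using stationary_path_pos[OF assms(1,3), of t]
    by (intro tendsto_powr Suc.IH tendsto_const) simp
  ultimately show ?case by (simp add: production_def tendsto_mult)
qed

lemma limit_capital_eq_stationary_path:
  assumes "0 < \<alpha>" "\<alpha> < 1" "0 < k0" "k0 < 1"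
  shows "limit_capital \<alpha> k0 t = stationary_path \<alpha> k0 t"
proof -
  \<comment> \<open>Only finitely many horizons end before date \<open>t\<close>; they do not affect
    the limit.\<close>
  have "eventually (\<lambda>T. saving_path \<alpha> k0 T t = opt_capital \<alpha> k0 T t) sequentially"
    using eventually_ge_at_top[of t]
    by eventually_elim (use assms in \<open>simp add: opt_capital_eq_saving_path\<close>)
  with saving_path_tendsto[OF assms(1-3)]
  have "(\<lambda>T. opt_capital \<alpha> k0 T t) \<longlonglongrightarrow> stationary_path \<alpha> k0 t"
    by (rule Lim_transform_eventually)
  then show ?thesis unfolding limit_capital_def by (rule limI)
qed

theorem mainTheorem6:
  fixes \<alpha> k0 :: real
  assumes "0 < \<alpha>" and "\<alpha> < 1"
    and "0 < k0" and "k0 < 1"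
  shows "\<forall>t. limit_capital \<alpha> k0 (t + 1) / production \<alpha> (limit_capital \<alpha> k0 t) = \<alpha>"
proof
  fix t
  have "0 < production \<alpha> (stationary_path \<alpha> k0 t)"
    using stationary_path_pos[OF assms(1,3), of t] by (simp add: production_def)
  then show "limit_capital \<alpha> k0 (t + 1) / production \<alpha> (limit_capital \<alpha> k0 t) = \<alpha>"
    by (simp add: limit_capital_eq_stationary_path[OF assms])
qed

end
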